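(* Let $\Omega\subset\mathbb{R}^d$ be a bounded open set, $F=\partial\Omega$, and $\varrho\in\mathbb{R}$. There exists a gauge function $h\in\mathcal{R}_\varrho$ such that $F$ is $h$-Minkowski measurable (relative to $\Omega$) if and only if the volume function $V_F:r\mapsto |F_r\cap\Omega|_d$, $r>0$, is regularly varying at $0$ with index $\varrho$, i.e. if and only if $V_F\in\mathcal{R}_\varrho$.
   Context: $|\cdot|_d$ is Lebesgue measure in $\mathbb{R}^d$, and $F_r:=\{x\in\mathbb{R}^d: d(x,F)\le r\}$ is the $r$-parallel set of $F$. For $\varrho\in\mathbb{R}$, $\mathcal{R}_\varrho$ is the family of functions $h:(0,y_0)\to(0,\infty)$ (with some $y_0>0$, possibly $\infty$) that are regularly varying at $0$ of index $\varrho$: $h$ is measurable and $\lim_{y\searrow 0}h(ty)/h(y)=t^\varrho$ for all $t>0$. For a gauge function $h$ (a positive function on a right neighborhood of $0$), the $h$-Minkowski content of $F$ relative to $\Omega$ is $\mathcal{M}(h;F):=\lim_{r\searrow 0}|F_r\cap\Omega|_d/h(r)$, provided the limit exists. $F$ is called $h$-Minkowski measurable if this limit exists and $0<\mathcal{M}(h;F)<\infty$. *)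

theory Defs
  imports "HOL-Analysis.Analysis"
begin

text \<open>
  The library sets \<open>infdist x {} = 0\<close>; the guard restores the usual convention
  that the distance to the empty set is infinite.
\<close>
definition parallel_set :: "'a::metric_space set \<Rightarrow> real \<Rightarrow> 'a set" where
  "parallel_set F r = {x. F \<noteq> {} \<and> infdist x F \<le> r}"

text \<open>
  \<^const>\<open>measure\<close> is real-valued, so this is the intended volume only where the set
  has finite measure, in particular whenever \<open>\<Omega>\<close> is bounded.
\<close>
definition volume_function :: "'a::euclidean_space set \<Rightarrow> 'a set \<Rightarrow> real \<Rightarrow> real" where
  "volume_function F \<Omega> r = measure lebesgue (parallel_set F r \<inter> \<Omega>)"

text \<open>
  A function on \<open>(0, y0)\<close> is represented by a total function whose values off \<open>(0, y0)\<close>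
  are irrelevant: for fixed \<open>t > 0\<close> the quotient only involves \<open>h\<close> on \<open>(0, y0)\<close> once
  \<open>y\<close> is small enough. Measurability is in the sense of Lebesgue.
\<close>
definition regularly_varying_at_0 :: "real \<Rightarrow> (real \<Rightarrow> real) set" where
  "regularly_varying_at_0 \<rho> =
     {h. \<exists>y0::ereal. 0 < y0 \<and>
           (\<forall>y. 0 < y \<and> ereal y < y0 \<longrightarrow> 0 < h y) \<and>
           h \<in> borel_measurable (lebesgue_on {y. 0 < y \<and> ereal y < y0}) \<and>
           (\<forall>t>0. ((\<lambda>y. h (t * y) / h y) \<longlongrightarrow> t powr \<rho>) (at_right 0))}"

definition gauge_function :: "(real \<Rightarrow> real) \<Rightarrow> bool" where
  "gauge_function h \<longleftrightarrow> (\<forall>\<^sub>F r in at_right 0. 0 < h r)"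

definition has_minkowski_content ::
    "(real \<Rightarrow> real) \<Rightarrow> 'a::euclidean_space set \<Rightarrow> 'a set \<Rightarrow> real \<Rightarrow> bool" where
  "has_minkowski_content h F \<Omega> M \<longleftrightarrow>
     ((\<lambda>r. volume_function F \<Omega> r / h r) \<longlongrightarrow> M) (at_right 0)"

text \<open>The content \<open>M\<close> ranges over the reals, so its finiteness is implicit.\<close>
definition minkowski_measurable ::
    "(real \<Rightarrow> real) \<Rightarrow> 'a::euclidean_space set \<Rightarrow> 'a set \<Rightarrow> bool" where
  "minkowski_measurable h F \<Omega> \<longleftrightarrow> (\<exists>M>0. has_minkowski_content h F \<Omega> M)"

end

theory Submission
  imports Defs
begin

text \<open>Regular variation survives passing to a function asymptotic to a positive multiple. If
  g/h tends to M with 0 < M, then g(ty)/g(y) is the product of g(ty)/h(ty) and h(ty)/h(y), divided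
  by g(y)/h(y), so it tends to M t^\<rho> / M = t^\<rho>; this is
  \<open>regularly_varying_at_0_asymp\<close>. Applied to g = V_F and a gauge h, it gives one
  direction, once V_F is known to be measurable, which follows from its monotonicity
  (\<open>mono_volume_function\<close>). Conversely, a regularly varying V_F serves as its own
  gauge, with content 1.\<close>

lemma eventually_at_right_0_pos_quotient:
  fixes g h :: "real \<Rightarrow> real"
  assumes "((\<lambda>y. g y / h y) \<longlongrightarrow> M) (at_right 0)" and "M > 0"
    and "\<forall>\<^sub>F y in at_right 0. 0 < h y"
  shows "\<forall>\<^sub>F y in at_right 0. 0 < g y"
  using order_tendstoD(1)[OF assms(1,2)] assms(3)
  by eventually_elim (auto simp: zero_less_divide_iff)

lemma regularly_varying_at_0_eventually_pos:
  assumes "h \<in> regularly_varying_at_0 \<rho>"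
  shows "\<forall>\<^sub>F y in at_right 0. 0 < h y"
proof -
  obtain y0 :: ereal where y0: "0 < y0" "\<And>y. 0 < y \<Longrightarrow> ereal y < y0 \<Longrightarrow> 0 < h y"
    using assms by (auto simp: regularly_varying_at_0_def)
  \<comment> \<open>\<open>y0\<close> may be infinite, while a right neighbourhood of 0 calls for a
    real endpoint.\<close>
  obtain b :: real where b: "0 < b" "ereal b < y0"
    using ereal_dense2[OF y0(1)] by (auto simp: zero_ereal_def)
  have "0 < h y" if "0 < y" "y < b" for y
  proof (rule y0(2)[OF that(1)])
    show "ereal y < y0" using that(2) b(2) by (meson ereal_less(2) less_ereal.simps(1) less_trans)
  qed
  then show ?thesis using b(1) by (auto simp: eventually_at_right)
qed

text \<open>The constant M cancels in g(ty)/g(y), so the index of h passes to g unchanged.\<close>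

lemma regularly_varying_at_0_asymp:
  assumes h: "h \<in> regularly_varying_at_0 \<rho>"
    and g: "g \<in> borel_measurable lebesgue"
    and lim: "((\<lambda>y. g y / h y) \<longlongrightarrow> M) (at_right 0)" and M: "M > 0"
  shows "g \<in> regularly_varying_at_0 \<rho>"
proof -
  note h_pos = regularly_varying_at_0_eventually_pos[OF h]
  note g_pos = eventually_at_right_0_pos_quotient[OF lim M h_pos]
  obtain b where b: "0 < b" "\<And>y. 0 < y \<Longrightarrow> y < b \<Longrightarrow> 0 < g y"
    using g_pos unfolding eventually_at_right_field by blast
  have "((\<lambda>y. g (t * y) / g y) \<longlongrightarrow> t powr \<rho>) (at_right 0)" if "t > 0" for t
  proof -
    \<comment> \<open>As y decreases to 0, so does ty, through positive values; hence limits and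
      eventual positivity at y carry over to ty.\<close>
    have scale: "filterlim (\<lambda>y. t * y) (at_right 0) (at_right 0)"
      using that by (auto simp: filterlim_at eventually_at_right_less 
          intro!: tendsto_eq_intros eventually_at_rightI[of 0 1])
    have "((\<lambda>y. h (t * y) / h y) \<longlongrightarrow> t powr \<rho>) (at_right 0)"
      using h that by (auto simp: regularly_varying_at_0_def)
    then have "((\<lambda>y. (g (t * y) / h (t * y)) * (h (t * y) / h y) / (g y / h y))
        \<longlongrightarrow> M * t powr \<rho> / M) (at_right 0)"
      using M by (intro tendsto_intros lim filterlim_compose[OF lim scale]) auto
    \<comment> \<open>The factors telescope only where h(y), h(ty) and g(y) are nonzero, hence only
      for small y.\<close>
    moreover have "\<forall>\<^sub>F y in at_right 0.
        (g (t * y) / h (t * y)) * (h (t * y) / h y) / (g y / h y) = g (t * y) / g y"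
      using h_pos g_pos eventually_compose_filterlim[OF h_pos scale]
      by eventually_elim (simp add: field_simps)
    ultimately have "((\<lambda>y. g (t * y) / g y) \<longlongrightarrow> M * t powr \<rho> / M) (at_right 0)"
      by (rule Lim_transform_eventually)
    then show ?thesis
      using M by simp
  qed
  moreover have "g \<in> borel_measurable (lebesgue_on {y. 0 < y \<and> ereal y < ereal b})"
    using g by (rule measurable_restrict_space1)
  ultimately show ?thesis
    using b by (auto simp: regularly_varying_at_0_def intro!: exI[of _ "ereal b"])
qed

lemma closed_parallel_set: "closed (parallel_set F r)"
proof (cases "F = {}")
  case False
  have "closed {x. infdist x F \<le> r}"
    by (intro closed_Collect_le continuous_intros)
  with False show ?thesis by (simp add: parallel_set_def)
qed (simp add: parallel_set_def)

text \<open>Larger radii give larger sets. Finite measure of \<Omega> matters: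
  \<open>measure\<close> returns 0 on sets of infinite measure, which could break
  monotonicity.\<close>

lemma mono_volume_function:
  assumes "\<Omega> \<in> lmeasurable"
  shows "mono (volume_function F \<Omega>)"
proof (rule monoI)
  have lm: "parallel_set F r \<inter> \<Omega> \<in> lmeasurable" for r
    using assms closed_parallel_set
    by (metis Int_commute fmeasurable_Int_fmeasurable lborelD borel_closed sets_completionI_sets)
  fix r s :: real assume "r \<le> s"
  then show "volume_function F \<Omega> r \<le> volume_function F \<Omega> s"
    unfolding volume_function_def
    by (intro measure_mono_fmeasurable fmeasurableD lm) (auto simp: parallel_set_def)
qed

theorem theorem2p4:
  fixes \<Omega> F :: "'a::euclidean_space set" and \<rho> :: real
  assumes "bounded \<Omega>" and "open \<Omega>" and "F = frontier \<Omega>"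
  shows "(\<exists>h. gauge_function h \<and> h \<in> regularly_varying_at_0 \<rho> \<and> minkowski_measurable h F \<Omega>)
    \<longleftrightarrow> volume_function F \<Omega> \<in> regularly_varying_at_0 \<rho>"
proof
  have "\<Omega> \<in> lmeasurable" using assms(1,2) by (rule lmeasurable_open)
  \<comment> \<open>A monotone real function is Borel, and so measurable for the completion
    \<open>lebesgue\<close>.\<close>
  then have meas: "volume_function F \<Omega> \<in> borel_measurable lebesgue"
    by (intro measurable_completion) (simp add: borel_measurable_mono mono_volume_function)
  assume "\<exists>h. gauge_function h \<and> h \<in> regularly_varying_at_0 \<rho> \<and> minkowski_measurable h F \<Omega>"
  then show "volume_function F \<Omega> \<in> regularly_varying_at_0 \<rho>"
    using regularly_varying_at_0_asymp[OF _ meas]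
    by (auto simp: minkowski_measurable_def has_minkowski_content_def)
next
  let ?V = "volume_function F \<Omega>"
  assume V: "?V \<in> regularly_varying_at_0 \<rho>"
  note pos = regularly_varying_at_0_eventually_pos[OF V]
  \<comment> \<open>Eventual positivity makes the quotient equal to 1 near 0; at a zero of
    \<open>?V\<close> it would be 0/0 = 0.\<close>
  have "((\<lambda>r. ?V r / ?V r) \<longlongrightarrow> 1) (at_right 0)"
    using pos by (intro tendsto_eventually) (auto elim: eventually_mono)
  then have "minkowski_measurable ?V F \<Omega>"
    unfolding minkowski_measurable_def has_minkowski_content_def by (intro exI[of _ 1]) simp
  with V pos show "\<exists>h. gauge_function h \<and> h \<in> regularly_varying_at_0 \<rho> \<and> minkowski_measurable h F \<Omega>"
    by (auto simp: gauge_function_def)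
qed

end
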